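(* If one of the values $$-a,\ -b,\ (g+1)/2,\ a+g/2+1,\ b+g/2+1,\ c+g/2+1,$$ $$a+b+c+g+2,\quad a+c+g/2+3/2,\quad b+c+g/2+3/2,$$ $$e_5,\ e_6,\ e_7,\ e_8$$ is an integer, then the equation $S\!E_4(a,b,c,g,u)$ is reducible.
   Context: Notation: $\partial=d/dx$, $\theta=x\partial$; $a,b,c,g,u$ are complex parameters. The operator $E_4$: for exponents $e_1,\dots,e_8$ with $e_1+\cdots+e_8=4$, $E_4=\mathcal T_0+\mathcal T_1\partial+\mathcal T_2\partial^2$ with $\mathcal T_0=(\theta+e_5)(\theta+e_6)(\theta+e_7)(\theta+e_8)$, $\mathcal T_1=-2\theta^3+(s_{11}-s_{13}-5)\theta^2+(3s_{11}-s_{21}+s_{22}-s_{23}-8)\theta+\mathcal T_{10}$, $\mathcal T_2=(\theta-e_1+2)(\theta-e_2+2)$, $54\mathcal T_{10}=-4s_{11}^3+4s_{12}^3-(6s_{12}-27)s_{11}^2+(6s_{11}-27)s_{12}^2+(9s_{21}-18s_{22}+9s_{23}+36)s_{11}-(9s_{22}-18s_{21}+9s_{23}-18)s_{12}-81s_{21}+81s_{22}-27s_{23}-27s_3-135$, where $s_{11}=e_1+e_2$, $s_{12}=e_3+e_4$, $s_{13}=e_5+e_6+e_7+e_8$, $s_{21}=e_1e_2$, $s_{22}=e_3e_4$, $s_{23}=e_5e_6+e_5e_7+e_5e_8+e_6e_7+e_6e_8+e_7e_8$, $s_3=e_6e_7e_8+e_5e_7e_8+e_5e_6e_8+e_5e_6e_7$.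 The operator $S\!E_4(a,b,c,g,u)$ is $E_4$ with $e_1=2a+2c+g-u+2$, $e_2=a+c-u+1$, $e_3=2b+2c+g-u+2$, $e_4=b+c-u+1$, $e_5=u+1$, $e_6=u-a-b-2c-g-1$, $e_7=u-2c$, $e_8=u-2-g-2c-2b-2a$. An operator $E\in\mathbb C(x)[\partial]$ is reducible if $E=F_1\circ F_2$ with $F_1,F_2\in\mathbb C(x)[\partial]$ of positive order. *)

theory Defs
  imports Complex_Main "HOL-Computational_Algebra.Computational_Algebra"
begin

type_synonym ratfun = "complex poly fract"

text \<open>The derivation d/dx of the field of rational functions, by the quotient rule.  The result
  does not depend on the chosen fraction, as \<open>ratfun_deriv_Fract\<close> confirms.\<close>

definition ratfun_deriv :: "ratfun \<Rightarrow> ratfun" where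
  "ratfun_deriv f = (THE h. \<forall>p q. q \<noteq> 0 \<longrightarrow> f = Fract p q \<longrightarrow>
     h = Fract (pderiv p * q - p * pderiv q) (q * q))"

lemma ratfun_deriv_well_defined:
  fixes p q r s :: "complex poly"
  assumes "q \<noteq> 0" "s \<noteq> 0" "Fract p q = Fract r s"
  shows "Fract (pderiv p * q - p * pderiv q) (q * q) = Fract (pderiv r * s - r * pderiv s) (s * s)"
proof -
  have eq: "p * s = r * q" using assms by (simp add: eq_fract)
  have "pderiv (p * s) = pderiv (r * q)" by (simp only: eq)
  hence d: "p * pderiv s + s * pderiv p = r * pderiv q + q * pderiv r"
    by (simp only: pderiv_mult)
  have "(pderiv p * q - p * pderiv q) * (s * s)
      = q * s * (p * pderiv s + s * pderiv p) - (p * s) * (q * pderiv s + s * pderiv q)"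
    by (simp add: algebra_simps)
  also have "\<dots> = q * s * (r * pderiv q + q * pderiv r) - (r * q) * (q * pderiv s + s * pderiv q)"
    by (simp only: d eq)
  also have "\<dots> = (pderiv r * s - r * pderiv s) * (q * q)"
    by (simp add: algebra_simps)
  finally show ?thesis using assms by (simp add: eq_fract)
qed

lemma ratfun_deriv_Fract:
  assumes "q \<noteq> 0"
  shows "ratfun_deriv (Fract p q) = Fract (pderiv p * q - p * pderiv q) (q * q)"
  unfolding ratfun_deriv_def
  by (rule the_equality) (use assms ratfun_deriv_well_defined in blast)+

lemma ratfun_deriv_add: "ratfun_deriv (f + g) = ratfun_deriv f + ratfun_deriv g"
proof (cases f, cases g)
  fix p q r s :: "complex poly"
  assume f: "f = Fract p q" "q \<noteq> 0" and g: "g = Fract r s" "s \<noteq> 0"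
  have "(pderiv (p * s + r * q) * (q * s) - (p * s + r * q) * pderiv (q * s)) * ((q * q) * (s * s))
      = ((pderiv p * q - p * pderiv q) * (s * s) + (pderiv r * s - r * pderiv s) * (q * q))
        * ((q * s) * (q * s))"
    unfolding pderiv_add pderiv_mult by algebra
  with f g show ?thesis by (simp add: ratfun_deriv_Fract eq_fract
        del: mult_cancel_right mult_cancel_left)
qed

lemma ratfun_deriv_mult: "ratfun_deriv (f * g) = ratfun_deriv f * g + f * ratfun_deriv g"
proof (cases f, cases g)
  fix p q r s :: "complex poly"
  assume f: "f = Fract p q" "q \<noteq> 0" and g: "g = Fract r s" "s \<noteq> 0"
  have "(pderiv (p * r) * (q * s) - (p * r) * pderiv (q * s)) * ((q * q * s) * (q * (s * s)))
      = ((pderiv p * q - p * pderiv q) * r * (q * (s * s))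
         + p * (pderiv r * s - r * pderiv s) * (q * q * s)) * ((q * s) * (q * s))"
    unfolding pderiv_mult by algebra
  with f g show ?thesis by (simp add: ratfun_deriv_Fract eq_fract
        del: mult_cancel_right mult_cancel_left)
qed

lemma ratfun_deriv_0 [simp]: "ratfun_deriv 0 = 0"
  using ratfun_deriv_Fract[of 1 0] by (simp flip: Zero_fract_def)

lemma ratfun_deriv_1 [simp]: "ratfun_deriv 1 = 0"
  using ratfun_deriv_Fract[of 1 1] by (simp add: fract_collapse)

text \<open>The ring of linear differential operators with rational function coefficients.
  The operator \<open>\<Sum>i. a\<^sub>i \<partial>\<^sup>i\<close> is stored as the polynomial with coefficients \<open>a\<^sub>i\<close>, with the
  coefficients standing to the left of the derivations.  The commutative product of polynomials
  is not the composition of operators, hence the separate type.\<close>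

datatype diff_op = Diff_Op (op_poly: "ratfun poly")

text \<open>Left multiplication by \<open>\<partial>\<close>: since \<open>\<partial> \<circ> b = b' + b \<partial>\<close>, it sends \<open>\<Sum>i. b\<^sub>i \<partial>\<^sup>i\<close> to
  \<open>\<Sum>i. b\<^sub>i' \<partial>\<^sup>i + b\<^sub>i \<partial>\<^sup>i\<^sup>+\<^sup>1\<close>.\<close>

definition d_left :: "ratfun poly \<Rightarrow> ratfun poly" where
  "d_left p = map_poly ratfun_deriv p + pCons 0 p"

definition op_compose :: "ratfun poly \<Rightarrow> ratfun poly \<Rightarrow> ratfun poly" where
  "op_compose p q = (\<Sum>i\<le>degree p. smult (coeff p i) ((d_left ^^ i) q))"

lemma d_left_0 [simp]: "d_left 0 = 0"
  by (simp add: d_left_def)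

lemma d_left_add: "d_left (p + q) = d_left p + d_left q"
  by (rule poly_eqI)
     (simp add: d_left_def coeff_map_poly coeff_pCons ratfun_deriv_add algebra_simps
           split: nat.splits)

lemma d_left_smult: "d_left (smult f p) = smult (ratfun_deriv f) p + smult f (d_left p)"
  by (rule poly_eqI)
     (simp add: d_left_def coeff_map_poly coeff_pCons ratfun_deriv_mult algebra_simps
           split: nat.splits)

lemma d_left_funpow_0 [simp]: "(d_left ^^ i) 0 = 0"
  by (induction i) auto

lemma d_left_funpow_add: "(d_left ^^ i) (p + q) = (d_left ^^ i) p + (d_left ^^ i) q"
  by (induction i) (auto simp: d_left_add)

lemma d_left_sum: "d_left (sum f A) = (\<Sum>i\<in>A. d_left (f i))"
  by (induction A rule: infinite_finite_induct) (auto simp: d_left_add)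

lemma op_compose_eq:
  assumes "degree p \<le> n"
  shows "op_compose p q = (\<Sum>i\<le>n. smult (coeff p i) ((d_left ^^ i) q))"
  unfolding op_compose_def
  by (rule sum.mono_neutral_left) (use assms in \<open>auto simp: coeff_eq_0\<close>)

lemma op_compose_0_left [simp]: "op_compose 0 q = 0"
  by (simp add: op_compose_def)

lemma op_compose_0_right [simp]: "op_compose p 0 = 0"
  by (simp add: op_compose_def)

lemma op_compose_1_left [simp]: "op_compose 1 q = q"
  by (simp add: op_compose_def)

lemma op_compose_add_left: "op_compose (p + q) r = op_compose p r + op_compose q r"
proof -
  define n where "n = max (degree p) (degree q)"
  have "degree (p + q) \<le> n" "degree p \<le> n" "degree q \<le> n"
    by (auto simp: n_def degree_add_le_max)
  thus ?thesis
    by (simp add: op_compose_eq[of _ n] smult_add_left sum.distrib)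
qed

lemma op_compose_add_right: "op_compose p (q + r) = op_compose p q + op_compose p r"
  by (simp add: op_compose_def d_left_funpow_add smult_add_right sum.distrib)

lemma op_compose_smult_left: "op_compose (smult f p) q = smult f (op_compose p q)"
  proof -
  have "smult f (sum h A) = (\<Sum>i\<in>A. smult f (h i))" for h :: "nat \<Rightarrow> ratfun poly" and A
    by (induction A rule: infinite_finite_induct) (auto simp: smult_add_right)
  thus ?thesis
    by (simp add: op_compose_eq[of _ "degree p"] degree_smult_le)
qed

lemma op_compose_pCons_0: "op_compose (pCons 0 p) q = op_compose p (d_left q)"
proof -
  have "degree (pCons 0 p) \<le> Suc (degree p)"
    by (simp add: degree_pCons_le)
  hence "op_compose (pCons 0 p) q
      = (\<Sum>i\<le>Suc (degree p). smult (coeff (pCons 0 p) i) ((d_left ^^ i) q))"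
    by (rule op_compose_eq)
  also have "\<dots> = op_compose p (d_left q)"
    by (subst sum.atMost_Suc_shift) (simp add: op_compose_def funpow_swap1)
  finally show ?thesis .
qed

lemma d_left_op_compose: "d_left (op_compose p q) = op_compose (d_left p) q"
proof -
  have deg: "degree (map_poly ratfun_deriv p) \<le> degree p"
    by (rule degree_le) (simp add: coeff_map_poly coeff_eq_0)
  have "d_left (op_compose p q)
      = (\<Sum>i\<le>degree p. smult (ratfun_deriv (coeff p i)) ((d_left ^^ i) q))
      + (\<Sum>i\<le>degree p. smult (coeff p i) ((d_left ^^ i) (d_left q)))"
    by (simp add: op_compose_def d_left_sum d_left_smult sum.distrib funpow_swap1)
  also have "\<dots> = op_compose (map_poly ratfun_deriv p) q + op_compose (pCons 0 p) q"
    unfolding op_compose_pCons_0 op_compose_eq[OF deg]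
    by (simp add: op_compose_def coeff_map_poly)
  finally show ?thesis
    by (simp add: d_left_def op_compose_add_left)
qed

lemma d_left_funpow_op_compose: "(d_left ^^ i) (op_compose p q) = op_compose ((d_left ^^ i) p) q"
  by (induction i) (auto simp: d_left_op_compose)

lemma op_compose_sum_left: "op_compose (sum f A) q = (\<Sum>i\<in>A. op_compose (f i) q)"
  by (induction A rule: infinite_finite_induct) (auto simp: op_compose_add_left)

lemma op_compose_assoc: "op_compose (op_compose p q) r = op_compose p (op_compose q r)"
  by (simp add: op_compose_def[of p] op_compose_sum_left op_compose_smult_left
        d_left_funpow_op_compose)

lemma d_left_funpow_1: "(d_left ^^ i) 1 = monom 1 i"
proof (induction i)
  case (Suc i)
  have "map_poly ratfun_deriv (monom 1 i) = 0"
    by (rule poly_eqI) (simp add: coeff_map_poly)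
  with Suc show ?case by (simp add: d_left_def monom_Suc)
qed simp

lemma op_compose_1_right [simp]: "op_compose p 1 = p"
  by (simp add: op_compose_def d_left_funpow_1 smult_monom poly_as_sum_of_monoms)

instantiation diff_op :: ring_1
begin

definition "0 = Diff_Op 0"
definition "1 = Diff_Op 1"
definition "P + Q = Diff_Op (op_poly P + op_poly Q)"
definition "P - Q = Diff_Op (op_poly P - op_poly Q)"
definition "- P = Diff_Op (- op_poly P)"
definition "P * Q = Diff_Op (op_compose (op_poly P) (op_poly Q))"

instance
  by standard
     (auto simp: zero_diff_op_def one_diff_op_def plus_diff_op_def minus_diff_op_def
        uminus_diff_op_def times_diff_op_def op_compose_assoc op_compose_add_left
        op_compose_add_right)

end

definition op_order :: "diff_op \<Rightarrow> nat" where
  "op_order P = degree (op_poly P)"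

definition op_fun :: "ratfun \<Rightarrow> diff_op" where
  "op_fun f = Diff_Op [:f:]"

definition op_const :: "complex \<Rightarrow> diff_op" where
  "op_const z = op_fun (to_fract [:z:])"

definition op_x :: diff_op where
  "op_x = op_fun (to_fract [:0, 1:])"

definition op_d :: diff_op where
  "op_d = Diff_Op [:0, 1:]"

definition op_theta :: diff_op where
  "op_theta = op_x * op_d"

lemma op_d_mult_op_fun: "op_d * op_fun f = op_fun f * op_d + op_fun (ratfun_deriv f)"
  by (simp add: op_d_def op_fun_def times_diff_op_def plus_diff_op_def op_compose_def d_left_def
        map_poly_pCons)

definition reducible_op :: "diff_op \<Rightarrow> bool" where
  "reducible_op P \<longleftrightarrow> (\<exists>F1 F2. P = F1 * F2 \<and> op_order F1 > 0 \<and> op_order F2 > 0)"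

text \<open>The operator with local exponents \<open>e 1, \<dots>, e 8\<close>.  It is meant for exponents with sum 4
  (the Fuchs relation), which \<open>SE4_exponents\<close> below satisfies identically.\<close>

definition T10 :: "(nat \<Rightarrow> complex) \<Rightarrow> complex" where
  "T10 e = (let
       s11 = e 1 + e 2; s12 = e 3 + e 4;
       s21 = e 1 * e 2; s22 = e 3 * e 4;
       s23 = e 5 * e 6 + e 5 * e 7 + e 5 * e 8 + e 6 * e 7 + e 6 * e 8 + e 7 * e 8;
       s3 = e 6 * e 7 * e 8 + e 5 * e 7 * e 8 + e 5 * e 6 * e 8 + e 5 * e 6 * e 7
     in (- 4 * s11 ^ 3 + 4 * s12 ^ 3 - (6 * s12 - 27) * s11 ^ 2 + (6 * s11 - 27) * s12 ^ 2
         + (9 * s21 - 18 * s22 + 9 * s23 + 36) * s11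
         - (9 * s22 - 18 * s21 + 9 * s23 - 18) * s12
         - 81 * s21 + 81 * s22 - 27 * s23 - 27 * s3 - 135) / 54)"

definition T0 :: "(nat \<Rightarrow> complex) \<Rightarrow> diff_op" where
  "T0 e = (op_theta + op_const (e 5)) * (op_theta + op_const (e 6))
        * (op_theta + op_const (e 7)) * (op_theta + op_const (e 8))"

definition T1 :: "(nat \<Rightarrow> complex) \<Rightarrow> diff_op" where
  "T1 e = (let
       s11 = e 1 + e 2;
       s13 = e 5 + e 6 + e 7 + e 8;
       s21 = e 1 * e 2; s22 = e 3 * e 4;
       s23 = e 5 * e 6 + e 5 * e 7 + e 5 * e 8 + e 6 * e 7 + e 6 * e 8 + e 7 * e 8
     in - 2 * op_theta ^ 3 + op_const (s11 - s13 - 5) * op_theta ^ 2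
        + op_const (3 * s11 - s21 + s22 - s23 - 8) * op_theta + op_const (T10 e))"

definition T2 :: "(nat \<Rightarrow> complex) \<Rightarrow> diff_op" where
  "T2 e = (op_theta - op_const (e 1) + 2) * (op_theta - op_const (e 2) + 2)"

definition E4 :: "(nat \<Rightarrow> complex) \<Rightarrow> diff_op" where
  "E4 e = T0 e + T1 e * op_d + T2 e * op_d ^ 2"

definition SE4_exponents ::
    "complex \<Rightarrow> complex \<Rightarrow> complex \<Rightarrow> complex \<Rightarrow> complex \<Rightarrow> nat \<Rightarrow> complex" where
  "SE4_exponents a b c g u = (\<lambda>_. 0)(
     1 := 2 * a + 2 * c + g - u + 2,
     2 := a + c - u + 1,
     3 := 2 * b + 2 * c + g - u + 2,
     4 := b + c - u + 1,
     5 := u + 1,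
     6 := u - a - b - 2 * c - g - 1,
     7 := u - 2 * c,
     8 := u - 2 - g - 2 * c - 2 * b - 2 * a)"

lemma sum_SE4_exponents: "(\<Sum>i=1..8. SE4_exponents a b c g u i) = 4"
  by (simp add: SE4_exponents_def numeral_eq_Suc)

definition SE4 :: "complex \<Rightarrow> complex \<Rightarrow> complex \<Rightarrow> complex \<Rightarrow> complex \<Rightarrow> diff_op" where
  "SE4 a b c g u = E4 (SE4_exponents a b c g u)"

end

theory Submission
  imports Defs
begin

text \<open>The relation \<open>\<partial> p(\<theta>) = p(\<theta> + 1) \<partial>\<close> turns \<open>E\<^sub>4\<close> into a difference operator of order 2 in \<open>\<theta>\<close>, for
  which factorizations and shift operators are short polynomial identities.  There are explicit
  factorizations for \<open>e\<^sub>i = 0\<close> (\<open>5 \<le> i \<le> 8\<close>), \<open>a = 0\<close>, \<open>b = 0\<close> and \<open>g = -1\<close>.  They propagate along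
  relations \<open>E' P = Q E\<close> with \<open>0 \<noteq> P\<close> of order less than 4, since then \<open>E'\<close> is reducible iff \<open>E\<close> is:
  \<open>P = \<partial>\<close> shifts \<open>u\<close> by 1, and an operator \<open>P\<close> of order 2 shifts \<open>(c, u)\<close> by \<open>(1, 2)\<close>.  The
  exponents \<open>e\<^sub>5, e\<^sub>7, e\<^sub>8\<close> may be permuted within the family, and the resulting action on the
  parameters carries the remaining conditions to ones that the shift of \<open>c\<close> handles.\<close>

section \<open>Orders and leading coefficients of differential operators\<close>

text \<open>Allowing \<open>f = 0\<close> lets leading terms cancel in sums without a case
  distinction.\<close>

definition has_top :: "diff_op \<Rightarrow> nat \<Rightarrow> ratfun \<Rightarrow> bool" where
  "has_top P n f \<longleftrightarrow> op_order P \<le> n \<and> coeff (op_poly P) n = f"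

lemma has_top_order: "has_top P (op_order P) (lead_coeff (op_poly P))"
  by (simp add: has_top_def op_order_def)

lemma has_top_imp_order: "has_top P n f \<Longrightarrow> f \<noteq> 0 \<Longrightarrow> op_order P = n"
  unfolding has_top_def op_order_def by (metis le_antisym le_degree)

lemma diff_op_eq_0_iff: "P = 0 \<longleftrightarrow> op_poly P = 0"
  by (cases P) (simp add: zero_diff_op_def)

lemma has_top_nonzero: "has_top P n f \<Longrightarrow> f \<noteq> 0 \<Longrightarrow> P \<noteq> 0"
  by (auto simp: has_top_def diff_op_eq_0_iff)

lemma op_order_0 [simp]: "op_order 0 = 0"
  by (simp add: op_order_def zero_diff_op_def)

lemma op_order_1 [simp]: "op_order 1 = 0"
  by (simp add: op_order_def one_diff_op_def)

lemma has_top_weaken: "has_top P m f \<Longrightarrow> m < n \<Longrightarrow> has_top P n 0"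
  by (auto simp: has_top_def op_order_def intro: coeff_eq_0)

lemma has_top_add: "has_top P n f \<Longrightarrow> has_top Q n g \<Longrightarrow> has_top (P + Q) n (f + g)"
  by (auto simp: has_top_def op_order_def plus_diff_op_def intro: degree_add_le)

lemma has_top_diff: "has_top P n f \<Longrightarrow> has_top Q n g \<Longrightarrow> has_top (P - Q) n (f - g)"
  by (auto simp: has_top_def op_order_def minus_diff_op_def intro: degree_diff_le)

lemma has_top_op_fun: "has_top (op_fun f) 0 f"
  by (simp add: has_top_def op_order_def op_fun_def)

lemma has_top_op_d: "has_top op_d 1 1"
  by (simp add: has_top_def op_order_def op_d_def)

lemma d_left_top:
  assumes "degree q \<le> n"
  shows "degree (d_left q) \<le> Suc n" "coeff (d_left q) (Suc n) = coeff q n"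
proof -
  show "degree (d_left q) \<le> Suc n"
    using assms by (intro degree_le)
      (auto simp: d_left_def coeff_map_poly coeff_pCons coeff_eq_0 split: nat.splits)
  show "coeff (d_left q) (Suc n) = coeff q n"
    using assms by (simp add: d_left_def coeff_map_poly coeff_eq_0)
qed

lemma d_left_funpow_top:
  assumes "degree q \<le> n"
  shows "degree ((d_left ^^ i) q) \<le> n + i \<and> coeff ((d_left ^^ i) q) (n + i) = coeff q n"
  using assms by (induction i) (auto simp: d_left_top)

text \<open>Moving \<partial> past a coefficient only adds terms of lower order, so leading
  coefficients multiply as for commuting polynomials.\<close>

lemma has_top_mult:
  assumes "has_top P m f" "has_top Q n g"
  shows "has_top (P * Q) (m + n) (f * g)"
proof -
  define p q where "p = op_poly P" and "q = op_poly Q"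
  have p: "degree p \<le> m" "coeff p m = f" and q: "degree q \<le> n" "coeff q n = g"
    using assms by (auto simp: has_top_def op_order_def p_def q_def)
  note top = d_left_funpow_top[OF q(1)]
  have compose: "op_compose p q = (\<Sum>i\<le>m. smult (coeff p i) ((d_left ^^ i) q))"
    by (rule op_compose_eq[OF p(1)])
  have "degree (op_compose p q) \<le> m + n"
    unfolding compose
    by (intro degree_sum_le) (use top in \<open>auto intro!: order.trans[OF degree_smult_le]
        order.trans[OF conjunct1[OF top]]\<close>)
  moreover have "coeff (op_compose p q) (m + n) = f * g"
  proof -
    have "coeff (op_compose p q) (m + n)
        = (\<Sum>i\<le>m. coeff p i * coeff ((d_left ^^ i) q) (m + n))"
      by (simp add: compose coeff_sum)
    also have "\<dots> = (\<Sum>i\<in>{m}. coeff p i * coeff ((d_left ^^ i) q) (m + n))"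
    proof (rule sum.mono_neutral_right)
      show "\<forall>i\<in>{..m} - {m}. coeff p i * coeff ((d_left ^^ i) q) (m + n) = 0"
      proof
        fix i assume "i \<in> {..m} - {m}"
        hence "degree ((d_left ^^ i) q) < m + n"
          using conjunct1[OF top[of i]] by auto
        thus "coeff p i * coeff ((d_left ^^ i) q) (m + n) = 0"
          by (simp add: coeff_eq_0)
      qed
    qed auto
    also have "\<dots> = f * g"
      using top[of m] p q by (simp add: add.commute)
    finally show ?thesis .
  qed
  ultimately show ?thesis
    by (simp add: has_top_def op_order_def times_diff_op_def p_def q_def)
qed

instance diff_op :: ring_1_no_zero_divisors
proof
  fix P Q :: diff_op
  assume "P \<noteq> 0" "Q \<noteq> 0"
  thus "P * Q \<noteq> 0"
    using has_top_nonzero[OF has_top_mult[OF has_top_order[of P] has_top_order[of Q]]]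
    by (simp add: diff_op_eq_0_iff)
qed

lemma op_order_mult: "P \<noteq> 0 \<Longrightarrow> Q \<noteq> 0 \<Longrightarrow> op_order (P * Q) = op_order P + op_order Q"
  using has_top_imp_order[OF has_top_mult[OF has_top_order[of P] has_top_order[of Q]]]
  by (simp add: diff_op_eq_0_iff)

section \<open>Right Euclidean division, Bezout identities and common left multiples\<close>

text \<open>Leading coefficients are invertible, so a left multiple of \<open>B\<close> cancels the
  top term of \<open>A\<close>. The case \<open>R = 0\<close> is separate because \<open>0\<close>
  also has order 0.\<close>

lemma op_division:
  assumes "B \<noteq> 0"
  shows "\<exists>S R. A = S * B + R \<and> (R = 0 \<or> op_order R < op_order B)"
proof (induction "op_order A" arbitrary: A rule: less_induct)
  case less
  show ?case
  proof (cases "A = 0 \<or> op_order A < op_order B")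
    case True
    thus ?thesis by (intro exI[of _ 0] exI[of _ A]) auto
  next
    case False
    define k where "k = op_order A - op_order B"
    have order_A: "op_order A = k + op_order B" using False by (simp add: k_def)
    define f where "f = lead_coeff (op_poly A) / lead_coeff (op_poly B)"
    define S where "S = op_fun f * op_d ^ k"
    have "has_top (op_d ^ k) k 1" for k
      by (induction k)
         (use has_top_mult[OF has_top_op_d] in
           \<open>auto simp: has_top_def op_order_def one_diff_op_def\<close>)
    hence "has_top S k f"
      using has_top_mult[OF has_top_op_fun[of f]] by (fastforce simp: S_def)
    hence "has_top (S * B) (op_order A) (f * lead_coeff (op_poly B))"
      unfolding order_A by (intro has_top_mult has_top_order)
    moreover have "f * lead_coeff (op_poly B) = lead_coeff (op_poly A)"
      using assms by (simp add: f_def diff_op_eq_0_iff)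
    ultimately have "has_top (A - S * B) (op_order A) 0"
      using has_top_diff[OF has_top_order[of A]] by fastforce
    hence "A - S * B = 0 \<or> op_order (A - S * B) < op_order A"
      unfolding has_top_def op_order_def diff_op_eq_0_iff
      by (metis le_neq_implies_less leading_coeff_0_iff)
    thus ?thesis
    proof
      assume "A - S * B = 0"
      thus ?thesis by (intro exI[of _ S] exI[of _ 0]) simp
    next
      assume "op_order (A - S * B) < op_order A"
      from less[OF this] obtain S' R where
        "A - S * B = S' * B + R" "R = 0 \<or> op_order R < op_order B" by blast
      thus ?thesis
        by (intro exI[of _ "S + S'"] exI[of _ R]) (auto simp: algebra_simps)
    qed
  qed
qed

lemma op_order_0_left_inverse:
  assumes "B \<noteq> 0" "op_order B = 0"
  shows "\<exists>V. V * B = 1"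
  using op_division[OF assms(1), of 1] assms(2) by auto

text \<open>Euclid's algorithm: \<open>G\<close> is a greatest common right divisor and generates
  the left ideal of \<open>A\<close> and \<open>B\<close>.\<close>

lemma op_bezout:
  fixes A B :: diff_op
  assumes "B \<noteq> 0"
  shows "\<exists>G X Y A1 B1. G = X * A + Y * B \<and> A = A1 * G \<and> B = B1 * G"
  using assms
proof (induction "op_order B" arbitrary: A B rule: less_induct)
  case less
  obtain S R where SR: "A = S * B + R" "R = 0 \<or> op_order R < op_order B"
    using op_division[OF less.prems] by blast
  show ?case
  proof (cases "R = 0")
    case True
    with SR show ?thesis
      by (intro exI[of _ B] exI[of _ 0] exI[of _ 1] exI[of _ S]) auto
  next
    case False
    with SR less.hyps[of R B] obtain G X Y B1 R1 where
      G: "G = X * B + Y * R" "B = B1 * G" "R = R1 * G" by blast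
    have "G = Y * A + (X - Y * S) * B" using G(1) SR(1) by (simp add: algebra_simps)
    moreover have "A = (S * B1 + R1) * G"
      using SR(1) G(2,3) by (metis distrib_right mult.assoc)
    ultimately show ?thesis using G(2) by blast
  qed
qed

text \<open>Modulo left multiples of \<open>B\<close>, the class of \<open>A\<close> generates a
  module of dimension \<open>op_order B\<close> over the rational functions, so no nonzero operator
  of smaller order kills it. The proof runs Euclid's algorithm: reducing \<open>A\<close> modulo
  \<open>B\<close> keeps \<open>M\<close>, reducing \<open>B\<close> modulo \<open>A\<close>
  exchanges \<open>M\<close> and \<open>N\<close>.\<close>

lemma op_coprime_multiple_order:
  assumes "X * A + Y * B = 1" "M * A = N * B" "M \<noteq> 0" "B \<noteq> 0"
  shows "op_order B \<le> op_order M"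
  using assms
proof (induction "op_order A + op_order B" arbitrary: A B X Y M N rule: less_induct)
  case less
  note hyps = less.prems
  show ?case
  proof (cases "A = 0 \<or> op_order B = 0")
    case True
    thus ?thesis
    proof
      assume "A = 0"
      hence YB: "Y * B = 1" using hyps by simp
      hence "Y \<noteq> 0" by auto
      with YB hyps(4) show ?thesis using op_order_mult[of Y B] by simp
    qed simp
  next
    case False
    hence A: "A \<noteq> 0" and B: "op_order B > 0" by auto
    show ?thesis
    proof (cases "op_order B \<le> op_order A")
      case True
      obtain S R where SR: "A = S * B + R" "R = 0 \<or> op_order R < op_order B"
        using op_division[OF hyps(4)] by blast
      have "op_order R + op_order B < op_order A + op_order B" using SR(2) B True by auto
      moreover have "X * R + (X * S + Y) * B = 1"
        using hyps(1) unfolding SR(1) by (simp add: algebra_simps)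
      moreover have "M * R = (N - M * S) * B"
        using hyps(2) unfolding SR(1) by (simp add: algebra_simps)
      ultimately show ?thesis using less.hyps hyps(3,4) by blast
    next
      case False
      obtain S R where SR: "B = S * A + R" "R = 0 \<or> op_order R < op_order A"
        using op_division[OF A] by blast
      have N: "N \<noteq> 0" using hyps A by auto
      have "op_order R + op_order A < op_order A + op_order B" using SR(2) False by auto
      moreover have "Y * R + (Y * S + X) * A = 1"
        using hyps(1) unfolding SR(1) by (simp add: algebra_simps)
      moreover have "N * R = (M - N * S) * A"
        using hyps(2) unfolding SR(1) by (simp add: algebra_simps)
      ultimately have "op_order A \<le> op_order N" using less.hyps N A by blast
      moreover have "op_order M + op_order A = op_order N + op_order B"
        using hyps(2-4) A N by (metis op_order_mult)
      ultimately show ?thesis by simp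
    qed
  qed
qed

text \<open>The Ore condition with an order bound: if \<open>M * B = N * R\<close> for the remainder
  \<open>R\<close>, then \<open>N\<close> serves as multiplier of \<open>A\<close>.\<close>

lemma op_common_left_multiple:
  assumes "B \<noteq> 0"
  shows "\<exists>M N. M \<noteq> 0 \<and> M * A = N * B \<and> op_order M \<le> op_order B"
  using assms
proof (induction "op_order B" arbitrary: A B rule: less_induct)
  case less
  obtain S R where SR: "A = S * B + R" "R = 0 \<or> op_order R < op_order B"
    using op_division[OF less.prems] by blast
  show ?case
  proof (cases "R = 0")
    case True
    with SR show ?thesis by (intro exI[of _ 1] exI[of _ S]) auto
  next
    case False
    with SR less.hyps[of R B] obtain M N where
      MN: "M \<noteq> 0" "M * B = N * R" "op_order M \<le> op_order R" by blast
    have "N \<noteq> 0" using MN(1,2) less.prems by auto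
    moreover have "N * A = (N * S + M) * B"
      using SR(1) MN(2) by (simp add: algebra_simps)
    moreover have "op_order M + op_order B = op_order N + op_order R"
      using MN(1,2) less.prems False \<open>N \<noteq> 0\<close> by (metis op_order_mult)
    ultimately show ?thesis using MN(3) by (intro exI[of _ N] exI[of _ "N * S + M"]) simp
  qed
qed

section \<open>Reducibility and intertwining relations\<close>

lemma reducible_opI:
  assumes "P = F1 * F2" "op_order F2 > 0" "op_order F2 < op_order P"
  shows "reducible_op P"
proof -
  have "F1 \<noteq> 0" "F2 \<noteq> 0" using assms by auto
  hence "op_order F1 > 0" using assms op_order_mult by auto
  thus ?thesis using assms unfolding reducible_op_def by blast
qed

text \<open>By coprimality, the least common left multiple \<open>K * P = L * H\<close> has
  \<open>op_order K = op_order H\<close>. \<open>K\<close> generates the annihilator of the class of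
  \<open>P\<close> modulo \<open>H\<close>, so it is a right factor of \<open>E\<close>.\<close>

lemma reducible_op_coprime:
  assumes "X * P + Y * H = 1" "E * P = Q * H" "0 < op_order H" "op_order H < op_order E"
  shows "reducible_op E"
proof -
  have H: "H \<noteq> 0" using assms(3) by auto
  obtain K L where K: "K \<noteq> 0" "K * P = L * H" "op_order K \<le> op_order H"
    using op_common_left_multiple[OF H] by blast
  have order_K: "op_order K = op_order H"
    using op_coprime_multiple_order[OF assms(1) K(2,1) H] K(3) by simp
  obtain S R where SR: "E = S * K + R" "R = 0 \<or> op_order R < op_order K"
    using op_division[OF K(1)] by blast
  have "R * P = (Q - S * L) * H"
    using assms(2) K(2) unfolding SR(1) by (simp add: algebra_simps)
  hence "R = 0"
    using op_coprime_multiple_order[OF assms(1) _ _ H] SR(2) order_K by fastforce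
  thus ?thesis using reducible_opI[of E S K] SR(1) order_K assms by simp
qed

text \<open>The relation \<open>E' P = Q E\<close> makes right multiplication by \<open>P\<close> a nonzero homomorphism between
  the cyclic left modules of \<open>E'\<close> and \<open>E\<close>, which have the same dimension; if either of them is
  simple, it is an isomorphism.\<close>

lemma reducible_op_intertwine:
  assumes eq: "E' * P = Q * E" and P: "P \<noteq> 0" "op_order P < op_order E"
    and ord: "op_order E' = op_order E"
  shows "reducible_op E' \<longleftrightarrow> reducible_op E"
proof -
  have E: "E \<noteq> 0" using P by auto
  \<comment> \<open>Cancelling the greatest common right divisor \<open>G\<close> leaves a coprime
    pair \<open>P1\<close>, \<open>E1\<close> that satisfies the same relation.\<close>
  obtain G X Y P1 E1 where G: "G = X * P + Y * E" "P = P1 * G" "E = E1 * G"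
    using op_bezout[OF E] by blast
  have nz: "G \<noteq> 0" "P1 \<noteq> 0" "E1 \<noteq> 0" using P(1) E G(2,3) by auto
  have "(X * P1 + Y * E1) * G = 1 * G"
    using G by (simp add: distrib_right mult.assoc)
  hence coprime: "X * P1 + Y * E1 = 1" using nz(1) by (simp only: mult_cancel_right) simp
  have "(E' * P1) * G = (Q * E1) * G" using eq G(2,3) by (metis mult.assoc)
  hence eq1: "E' * P1 = Q * E1" using nz(1) by simp
  have order_E: "op_order E = op_order E1 + op_order G" using G(3) nz op_order_mult by simp
  have "op_order P = op_order P1 + op_order G" using G(2) nz op_order_mult by simp
  hence order_G: "op_order G < op_order E" using P(2) by simp
  show ?thesis
  proof (cases "op_order G = 0")
    case False
    \<comment> \<open>Here \<open>G\<close> is a proper right factor of \<open>E\<close>, and the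
      coprime pair gives a right factor of \<open>E'\<close> of order
      \<open>op_order E1\<close>.\<close>
    hence "reducible_op E" using reducible_opI[OF G(3)] order_G by simp
    moreover have "reducible_op E'"
      using reducible_op_coprime[OF coprime eq1] False order_E order_G ord by simp
    ultimately show ?thesis by simp
  next
    case order_G: True
    show ?thesis
    proof
      assume "reducible_op E'"
      then obtain F1 F2 where F: "E' = F1 * F2" "op_order F1 > 0" "op_order F2 > 0"
        by (auto simp: reducible_op_def)
      hence F_nz: "F1 \<noteq> 0" "F2 \<noteq> 0" by auto
      hence order_F: "op_order E = op_order F1 + op_order F2"
        using F(1) ord op_order_mult by simp
      \<comment> \<open>Right multiplication by \<open>P1\<close> maps the submodule generated by
        \<open>F2\<close> onto the one generated by \<open>G'\<close> modulo \<open>E1\<close>. The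
        latter is proper if \<open>G'\<close> has positive order, and nonzero if \<open>E2\<close>
        has.\<close>
      obtain G' X' Y' R E2 where
        G': "G' = X' * (F2 * P1) + Y' * E1" "F2 * P1 = R * G'" "E1 = E2 * G'"
        using op_bezout[OF nz(3), of "F2 * P1"] by blast
      have G'_nz: "G' \<noteq> 0" "E2 \<noteq> 0" using G'(3) nz(3) by auto
      have "(X' * R + Y' * E2) * G' = 1 * G'"
        using G' by (simp add: distrib_right mult.assoc)
      hence coprime': "X' * R + Y' * E2 = 1"
        using G'_nz(1) by (simp only: mult_cancel_right) simp
      have "(F1 * R) * G' = (Q * E2) * G'"
        using eq1 F(1) G'(2,3) by (metis mult.assoc)
      hence "F1 * R = Q * E2" using G'_nz(1) by simp
      hence "op_order E2 \<le> op_order F1"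
        using op_coprime_multiple_order[OF coprime'] F_nz(1) G'_nz(2) by blast
      moreover have order_E1: "op_order E1 = op_order E2 + op_order G'"
        using G'(3) G'_nz op_order_mult by simp
      ultimately have "op_order G' > 0" using order_E order_G order_F F(3) by simp
      moreover have "op_order E2 \<noteq> 0"
      proof
        \<comment> \<open>Otherwise \<open>F2\<close>, whose order is too small, would annihilate
          the class of \<open>P1\<close> modulo \<open>E1\<close>.\<close>
        assume "op_order E2 = 0"
        then obtain V where "V * E2 = 1" using op_order_0_left_inverse G'_nz(2) by blast
        hence "V * E1 = G'" using G'(3) by (metis mult.assoc mult_1)
        hence "F2 * P1 = (R * V) * E1" using G'(2) by (simp add: mult.assoc)
        hence "op_order E1 \<le> op_order F2"
          using op_coprime_multiple_order[OF coprime] F_nz(2) nz(3) by blast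
        thus False using order_E order_G order_F F(2) by simp
      qed
      moreover have "E = E2 * (G' * G)" using G(3) G'(3) by (simp add: mult.assoc)
      moreover have "op_order (G' * G) = op_order G'"
        using op_order_mult G'_nz nz order_G by simp
      ultimately show "reducible_op E"
        using reducible_opI[of E E2 "G' * G"] order_E order_G order_E1 by simp
    next
      assume "reducible_op E"
      then obtain F1 F2 where F: "E = F1 * F2" "op_order F1 > 0" "op_order F2 > 0"
        by (auto simp: reducible_op_def)
      hence "op_order F2 < op_order E'" using ord E op_order_mult[of F1 F2] by fastforce
      \<comment> \<open>Since \<open>G\<close> is invertible, the Bezout identity for
        \<open>P\<close> and \<open>E\<close> makes \<open>P\<close> coprime to the right factor
        \<open>F2\<close> as well.\<close>
      obtain V where V: "V * G = 1" using op_order_0_left_inverse nz(1) order_G by blast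
      have "(V * X) * P + (V * Y * F1) * F2 = V * G"
        using G(1) F(1) by (simp add: algebra_simps)
      moreover have "E' * P = (Q * F1) * F2" using eq F(1) by (simp add: mult.assoc)
      ultimately show "reducible_op E'"
        using reducible_op_coprime V F(3) \<open>op_order F2 < op_order E'\<close> by metis
    qed
  qed
qed

section \<open>Operators as polynomials in \<theta> and \<partial>\<close>

lemma op_const_0 [simp]: "op_const 0 = 0"
  by (simp add: op_const_def op_fun_def zero_diff_op_def)

lemma op_const_1 [simp]: "op_const 1 = 1"
  by (simp add: op_const_def op_fun_def one_diff_op_def flip: one_pCons)

lemma op_fun_add: "op_fun (f + g) = op_fun f + op_fun g"
  by (simp add: op_fun_def plus_diff_op_def)

lemma op_fun_mult: "op_fun (f * g) = op_fun f * op_fun g"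
  by (simp add: op_fun_def times_diff_op_def op_compose_def)

lemma op_const_add: "op_const (y + z) = op_const y + op_const z"
  by (simp add: op_const_def flip: op_fun_add to_fract_add)

lemma op_const_mult: "op_const (y * z) = op_const y * op_const z"
  by (simp add: op_const_def mult.commute flip: op_fun_mult to_fract_mult)

lemma op_const_diff: "op_const (y - z) = op_const y - op_const z"
  using op_const_add[of "y - z" z] by (simp add: algebra_simps)

lemma op_const_numeral [simp]: "op_const (numeral n) = numeral n"
  by (induction n) (simp_all only: numeral.simps op_const_1 op_const_add)

lemma ratfun_deriv_to_fract: "ratfun_deriv (to_fract p) = to_fract (pderiv p)"
  by (simp add: to_fract_def ratfun_deriv_Fract)

lemma op_d_op_const: "op_d * op_const z = op_const z * op_d"
  by (simp add: op_const_def op_d_mult_op_fun ratfun_deriv_to_fract pderiv_pCons)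
     (simp add: op_fun_def zero_diff_op_def)

lemma op_theta_op_const: "op_theta * op_const z = op_const z * op_theta"
proof -
  have "op_x * op_const z = op_const z * op_x"
    unfolding op_x_def op_const_def by (simp only: flip: op_fun_mult) (simp only: mult.commute)
  thus ?thesis by (metis op_theta_def op_d_op_const mult.assoc)
qed

lemma op_d_op_theta: "op_d * op_theta = (op_theta + 1) * op_d"
proof -
  have "op_d * op_x = op_theta + 1"
    by (simp add: op_x_def op_d_mult_op_fun op_theta_def ratfun_deriv_to_fract pderiv_pCons)
       (simp add: op_fun_def one_diff_op_def flip: one_pCons)
  thus ?thesis by (simp add: op_theta_def flip: mult.assoc)
qed

text \<open>Evaluation at \<open>op_theta\<close> by Horner's scheme; it is multiplicative because
  \<open>op_theta\<close> commutes with constants.\<close>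

definition theta_poly :: "complex poly \<Rightarrow> diff_op" where
  "theta_poly p = fold_coeffs (\<lambda>z P. op_const z + op_theta * P) p 0"

lemma theta_poly_0 [simp]: "theta_poly 0 = 0"
  by (simp add: theta_poly_def)

lemma theta_poly_pCons: "theta_poly (pCons z p) = op_const z + op_theta * theta_poly p"
proof (cases "z = 0 \<and> p = 0")
  case False
  thus ?thesis by (cases "p = 0") (auto simp: theta_poly_def)
qed simp

lemma theta_poly_add: "theta_poly (p + q) = theta_poly p + theta_poly q"
  by (induction p q rule: poly_induct2)
     (simp_all add: theta_poly_pCons op_const_add algebra_simps)

lemma theta_poly_smult: "theta_poly (smult z p) = op_const z * theta_poly p"
proof (induction p)
  case (pCons y p)
  have "op_theta * (op_const z * P) = op_const z * (op_theta * P)" for P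
    by (metis op_theta_op_const mult.assoc)
  with pCons show ?case by (simp add: theta_poly_pCons op_const_mult distrib_left)
qed simp

lemma theta_poly_mult: "theta_poly (p * q) = theta_poly p * theta_poly q"
proof (induction p)
  case (pCons y p)
  thus ?case
    by (simp add: mult_pCons_left theta_poly_add theta_poly_smult theta_poly_pCons
          distrib_right mult.assoc)
qed simp

lemma theta_poly_linear: "theta_poly [:z, 1:] = op_theta + op_const z"
  by (simp add: theta_poly_pCons)

lemma op_d_theta_poly: "op_d * theta_poly p = theta_poly (p \<circ>\<^sub>p [:1, 1:]) * op_d"
proof (induction p)
  case (pCons z p)
  have "theta_poly (pCons z p \<circ>\<^sub>p [:1, 1:]) * op_d
      = op_const z * op_d + (op_theta + 1) * (theta_poly (p \<circ>\<^sub>p [:1, 1:]) * op_d)"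
    by (simp add: pcompose_pCons theta_poly_add theta_poly_mult theta_poly_pCons algebra_simps)
  also have "\<dots> = op_d * theta_poly (pCons z p)"
    by (simp only: pCons(2)[symmetric] mult.assoc[symmetric] op_d_op_theta[symmetric])
       (simp add: theta_poly_pCons distrib_left op_d_op_const mult.assoc)
  finally show ?case ..
qed simp

text \<open>Degree 3 in \<partial> suffices: \<open>E4\<close> has degree 2, and the intertwining
  operators used below have degree 1.\<close>

definition theta_op ::
    "complex poly \<Rightarrow> complex poly \<Rightarrow> complex poly \<Rightarrow> complex poly \<Rightarrow> diff_op" where
  "theta_op p0 p1 p2 p3
     = theta_poly p0 + theta_poly p1 * op_d + theta_poly p2 * op_d ^ 2 + theta_poly p3 * op_d ^ 3"

abbreviation shift_poly :: "complex poly \<Rightarrow> complex poly" where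
  "shift_poly p \<equiv> p \<circ>\<^sub>p [:1, 1:]"

lemma op_d_theta_poly_left: "op_d * (theta_poly p * P) = theta_poly (shift_poly p) * (op_d * P)"
  by (metis op_d_theta_poly mult.assoc)

text \<open>With its counterpart below, this reduces an operator identity to four identities between
  commuting polynomials.\<close>

lemma theta_op_mult_1_2:
  "theta_op a0 a1 0 0 * theta_op b0 b1 b2 0
   = theta_op (a0 * b0) (a0 * b1 + a1 * shift_poly b0) (a0 * b2 + a1 * shift_poly b1)
       (a1 * shift_poly b2)"
  by (simp add: theta_op_def theta_poly_add theta_poly_mult distrib_left distrib_right mult.assoc
        op_d_theta_poly op_d_theta_poly_left power2_eq_square power3_eq_cube add_ac)

lemma theta_op_mult_2_1:
  "theta_op a0 a1 a2 0 * theta_op b0 b1 0 0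
   = theta_op (a0 * b0) (a0 * b1 + a1 * shift_poly b0)
       (a1 * shift_poly b1 + a2 * shift_poly (shift_poly b0)) (a2 * shift_poly (shift_poly b1))"
  by (simp add: theta_op_def theta_poly_add theta_poly_mult distrib_left distrib_right mult.assoc
        op_d_theta_poly op_d_theta_poly_left power2_eq_square power3_eq_cube add_ac)

definition T1_poly :: "(nat \<Rightarrow> complex) \<Rightarrow> complex poly" where
  "T1_poly e = (let
       s11 = e 1 + e 2;
       s13 = e 5 + e 6 + e 7 + e 8;
       s21 = e 1 * e 2; s22 = e 3 * e 4;
       s23 = e 5 * e 6 + e 5 * e 7 + e 5 * e 8 + e 6 * e 7 + e 6 * e 8 + e 7 * e 8
     in [:T10 e, 3 * s11 - s21 + s22 - s23 - 8, s11 - s13 - 5, - 2:])"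

lemma T0_theta: "T0 e = theta_poly ([:e 5, 1:] * [:e 6, 1:] * [:e 7, 1:] * [:e 8, 1:])"
  by (simp only: T0_def theta_poly_mult theta_poly_linear)

lemma T1_theta: "T1 e = theta_poly (T1_poly e)"
proof -
  have "theta_poly [:t, k1, k2, - 2:]
      = - 2 * op_theta ^ 3 + op_const k2 * op_theta ^ 2 + op_const k1 * op_theta + op_const t"
    for t k1 k2
  proof -
    have "op_const (- 2) = - 2" using op_const_diff[of 0 2] by simp
    moreover have "op_theta * (op_const z * P) = op_const z * (op_theta * P)" for z P
      by (metis op_theta_op_const mult.assoc)
    moreover have "op_theta * - 2 = - 2 * op_theta"
      using op_theta_op_const[of 2] by simp
    ultimately show ?thesis
      by (simp add: theta_poly_pCons op_theta_op_const power2_eq_square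
            power3_eq_cube algebra_simps mult_2 mult_2_right)
  qed
  thus ?thesis by (simp only: T1_def T1_poly_def Let_def)
qed

lemma T2_theta: "T2 e = theta_poly ([:2 - e 1, 1:] * [:2 - e 2, 1:])"
  by (simp add: T2_def theta_poly_mult theta_poly_linear op_const_diff algebra_simps
        del: mult_pCons_left mult_pCons_right)

lemma E4_theta:
  "E4 e = theta_op ([:e 5, 1:] * [:e 6, 1:] * [:e 7, 1:] * [:e 8, 1:]) (T1_poly e)
     ([:2 - e 1, 1:] * [:2 - e 2, 1:]) 0"
  by (simp only: E4_def theta_op_def T0_theta T1_theta T2_theta theta_poly_0 mult_zero_left
        add_0_right)

lemma theta_op_cong:
  "p0 = q0 \<Longrightarrow> p1 = q1 \<Longrightarrow> p2 = q2 \<Longrightarrow> p3 = q3 \<Longrightarrow> theta_op p0 p1 p2 p3 = theta_op q0 q1 q2 q3"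
  by simp

section \<open>The order of \<open>E4\<close>\<close>

lemma has_top_op_const: "has_top (op_const z) 0 (to_fract [:z:])"
  by (simp add: op_const_def has_top_op_fun)

lemma has_top_op_theta: "has_top op_theta 1 (to_fract [:0, 1:])"
  using has_top_mult[OF has_top_op_fun has_top_op_d, of "to_fract [:0, 1:]"]
  by (simp add: op_theta_def op_x_def)

lemma has_top_theta_poly_pCons:
  "has_top (theta_poly p) n f
   \<Longrightarrow> has_top (theta_poly (pCons z p)) (Suc n) (to_fract [:0, 1:] * f)"
  using has_top_add[OF has_top_weaken[OF has_top_op_const] has_top_mult[OF has_top_op_theta]]
  by (fastforce simp: theta_poly_pCons)

lemma has_top_theta_poly_const: "has_top (theta_poly [:z:]) 0 (to_fract [:z:])"
  by (simp add: theta_poly_pCons has_top_op_const)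

lemma has_top_theta_poly_linear: "has_top (theta_poly [:z, y:]) 1 (to_fract [:0, y:])"
  using has_top_theta_poly_pCons[OF has_top_theta_poly_const, of z y]
  by (simp flip: to_fract_mult)

text \<open>The three summands contribute \<open>x^4\<close>, \<open>- 2 * x^3\<close> and
  \<open>x^2\<close>, whatever the exponents are.\<close>

lemma has_top_E4: "has_top (E4 e) 4 (to_fract ([:0, 1:] ^ 2 * [:-1, 1:] ^ 2))"
proof -
  note L = has_top_theta_poly_linear[of _ 1]
  have "has_top (T0 e) (1 + 1 + 1 + 1)
      (to_fract [:0, 1:] * to_fract [:0, 1:] * to_fract [:0, 1:] * to_fract [:0, 1:])"
    unfolding T0_theta theta_poly_mult by (intro has_top_mult L)
  note T0 = this
  have "has_top (T1 e) (Suc (Suc (Suc 0)))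
      (to_fract [:0, 1:] * (to_fract [:0, 1:] * (to_fract [:0, 1:] * to_fract [:- 2:])))"
    unfolding T1_theta T1_poly_def Let_def
    by (intro has_top_theta_poly_pCons has_top_theta_poly_const)
  note T1 = has_top_mult[OF this has_top_op_d]
  have "has_top (T2 e) (1 + 1) (to_fract [:0, 1:] * to_fract [:0, 1:])"
    unfolding T2_theta theta_poly_mult by (intro has_top_mult L)
  note T2 = has_top_mult[OF this has_top_mult[OF has_top_op_d has_top_op_d]]
  have "has_top (E4 e) 4
      (to_fract [:0, 1:] * to_fract [:0, 1:] * to_fract [:0, 1:] * to_fract [:0, 1:]
       + to_fract [:0, 1:] * (to_fract [:0, 1:] * (to_fract [:0, 1:] * to_fract [:- 2:])) * 1
       + to_fract [:0, 1:] * to_fract [:0, 1:] * (1 * 1))"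
    unfolding E4_def power2_eq_square
    by (intro has_top_add) (use T0 T1 T2 in \<open>simp_all add: numeral_eq_Suc\<close>)
  thus ?thesis
    by (simp add: power2_eq_square flip: to_fract_mult to_fract_add)
qed

lemma op_order_E4: "op_order (E4 e) = 4"
  by (rule has_top_imp_order[OF has_top_E4]) simp

lemma reducible_E4I:
  assumes "E4 e = F1 * F2" "has_top F2 n f" "f \<noteq> 0" "0 < n" "n < 4"
  shows "reducible_op (E4 e)"
  using reducible_opI[OF assms(1)] has_top_imp_order[OF assms(2,3)] assms(4,5) op_order_E4
  by simp

lemma E4_intertwine:
  assumes "E4 e' * P = Q * E4 e" "has_top P n f" "f \<noteq> 0" "n < 4"
  shows "reducible_op (E4 e') \<longleftrightarrow> reducible_op (E4 e)"
  using reducible_op_intertwine[OF assms(1)] has_top_nonzero[OF assms(2,3)]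
    has_top_imp_order[OF assms(2,3)] assms(4) op_order_E4 by simp

section \<open>Shift relations and explicit factorizations\<close>

text \<open>Brings identities of coefficient polynomials into the complex numbers, where
  \<open>algebra\<close> applies.\<close>

lemma poly_ext: "(\<And>x. poly p x = poly q x) \<Longrightarrow> p = q" for p q :: "complex poly"
  by (simp add: ext flip: poly_eq_poly_eq_iff)

text \<open>One factor of \<open>T0 e\<close> is \<open>op_theta = op_x * op_d\<close>, so
  \<open>op_d\<close> can be split off from all three summands on the right.\<close>

lemma E4_factor_at_infinity:
  assumes "0 \<in> {e 5, e 6, e 7, e 8}"
  shows "reducible_op (E4 e)"
proof -
  have "[:0, 1:] dvd [:e 5, 1:] * [:e 6, 1:] * [:e 7, 1:] * [:e 8, 1:]"
    using assms by (fastforce intro: dvd_mult dvd_mult2)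
  then obtain A where "[:e 5, 1:] * [:e 6, 1:] * [:e 7, 1:] * [:e 8, 1:] = A * [:0, 1:]"
    by (metis dvd_def mult.commute)
  hence "T0 e = theta_poly A * op_x * op_d"
    unfolding T0_theta
    by (simp only: theta_poly_mult) (simp add: theta_poly_linear op_theta_def mult.assoc)
  hence "E4 e = (theta_poly A * op_x + T1 e + T2 e * op_d) * op_d"
    by (simp only: E4_def distrib_right power2_eq_square mult.assoc)
  thus ?thesis by (rule reducible_E4I) (use has_top_op_d in auto)
qed

text \<open>A division-free relation, so that \<open>algebra\<close> can treat \<open>T10 e\<close>
  as an unknown.\<close>

lemma T10_times_54:
  "54 * T10 e =
     - 4 * (e 1 + e 2) ^ 3 + 4 * (e 3 + e 4) ^ 3
     - (6 * (e 3 + e 4) - 27) * (e 1 + e 2) ^ 2 + (6 * (e 1 + e 2) - 27) * (e 3 + e 4) ^ 2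
     + (9 * (e 1 * e 2) - 18 * (e 3 * e 4) + 9 * (e 5 * e 6 + e 5 * e 7 + e 5 * e 8 + e 6 * e 7
          + e 6 * e 8 + e 7 * e 8) + 36) * (e 1 + e 2)
     - (9 * (e 3 * e 4) - 18 * (e 1 * e 2) + 9 * (e 5 * e 6 + e 5 * e 7 + e 5 * e 8 + e 6 * e 7
          + e 6 * e 8 + e 7 * e 8) - 18) * (e 3 + e 4)
     - 81 * (e 1 * e 2) + 81 * (e 3 * e 4)
     - 27 * (e 5 * e 6 + e 5 * e 7 + e 5 * e 8 + e 6 * e 7 + e 6 * e 8 + e 7 * e 8)
     - 27 * (e 6 * e 7 * e 8 + e 5 * e 7 * e 8 + e 5 * e 6 * e 8 + e 5 * e 6 * e 7) - 135"
  by (simp add: T10_def Let_def)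

text \<open>The last four exponents enter only through their elementary symmetric functions, so they
  may be permuted.\<close>

lemma E4_cong:
  assumes "e' 1 = e 1" "e' 2 = e 2" "e' 3 = e 3" "e' 4 = e 4"
    and prod: "[:e' 5, 1:] * [:e' 6, 1:] * [:e' 7, 1:] * [:e' 8, 1:]
      = [:e 5, 1:] * [:e 6, 1:] * [:e 7, 1:] * [:e 8, 1:]"
  shows "E4 e' = E4 e"
proof -
  have s13: "e' 5 + e' 6 + e' 7 + e' 8 = e 5 + e 6 + e 7 + e 8"
    and s23: "e' 5 * e' 6 + e' 5 * e' 7 + e' 5 * e' 8 + e' 6 * e' 7 + e' 6 * e' 8 + e' 7 * e' 8
      = e 5 * e 6 + e 5 * e 7 + e 5 * e 8 + e 6 * e 7 + e 6 * e 8 + e 7 * e 8"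
    and s3: "e' 6 * e' 7 * e' 8 + e' 5 * e' 7 * e' 8 + e' 5 * e' 6 * e' 8 + e' 5 * e' 6 * e' 7
      = e 6 * e 7 * e 8 + e 5 * e 7 * e 8 + e 5 * e 6 * e 8 + e 5 * e 6 * e 7"
    using prod by (simp_all add: algebra_simps)
  have "T10 e' = T10 e" "T1_poly e' = T1_poly e"
    by (simp_all only: T10_def T1_poly_def Let_def assms(1-4) s13 s23 s3)
  thus ?thesis
    unfolding E4_theta by (simp only: assms(1,2) prod)
qed

lemma SE4_exponents_simps:
  "SE4_exponents a b c g u 1 = 2 * a + 2 * c + g - u + 2"
  "SE4_exponents a b c g u (Suc 0) = 2 * a + 2 * c + g - u + 2"
  "SE4_exponents a b c g u 2 = a + c - u + 1"
  "SE4_exponents a b c g u 3 = 2 * b + 2 * c + g - u + 2"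
  "SE4_exponents a b c g u 4 = b + c - u + 1"
  "SE4_exponents a b c g u 5 = u + 1"
  "SE4_exponents a b c g u 6 = u - a - b - 2 * c - g - 1"
  "SE4_exponents a b c g u 7 = u - 2 * c"
  "SE4_exponents a b c g u 8 = u - 2 - g - 2 * c - 2 * b - 2 * a"
  by (simp_all add: SE4_exponents_def)

lemmas poly_eval = T1_poly_def Let_def poly_pcompose poly_mult poly_add poly_minus poly_diff
  poly_pCons poly_0 poly_1 SE4_exponents_simps

text \<open>Moving \<partial> past a coefficient replaces \<theta> by \<open>\<theta> + 1\<close>;
  correspondingly, \<open>u + 1\<close> lowers \<open>e 1\<close> to \<open>e 4\<close> by 1 and
  raises \<open>e 5\<close> to \<open>e 8\<close> by 1.\<close>

lemma SE4_shift_u: "reducible_op (SE4 a b c g (u + 1)) \<longleftrightarrow> reducible_op (SE4 a b c g u)"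
proof -
  define e e' where "e = SE4_exponents a b c g u" and "e' = SE4_exponents a b c g (u + 1)"
  note T10 = T10_times_54[of e] T10_times_54[of e']
  \<comment> \<open>Coefficients free of \<open>T10\<close> are compared directly; the others need
    its defining relations.\<close>
  have "E4 e' * theta_op 0 1 0 0 = theta_op 0 1 0 0 * E4 e"
    unfolding E4_theta theta_op_mult_1_2 theta_op_mult_2_1
    by (intro theta_op_cong; rule poly_ext; (simp only: e_def e'_def poly_eval)?;
        (algebra | (insert T10, simp only: e_def e'_def poly_eval, algebra)))
  hence "E4 e' * op_d = op_d * E4 e"
    by (simp add: theta_op_def one_pCons theta_poly_pCons)
  thus ?thesis
    unfolding SE4_def e_def e'_def by (rule E4_intertwine[OF _ has_top_op_d]) auto
qed

lemma has_top_theta_op: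
  assumes "has_top (theta_poly p0) (Suc n) f" "has_top (theta_poly p1) n h"
  shows "has_top (theta_op p0 p1 0 0) (Suc n) (f + h)"
  using has_top_add[OF assms(1)] has_top_mult[OF assms(2) has_top_op_d]
  by (simp add: theta_op_def)

text \<open>The quadratic part gives \<open>x^2\<close> and the other part \<open>- x\<close>, so
  these operators have order 2.\<close>

lemma has_top_theta_op_quadratic:
  "has_top (theta_op ([:y, 1:] * [:z, 1:]) [:w, - 1:] 0 0) 2 (to_fract [:0, -1, 1:])"
proof -
  have "has_top (theta_poly ([:y, 1:] * [:z, 1:])) (Suc 1) (to_fract [:0, 1:] * to_fract [:0, 1:])"
    unfolding theta_poly_mult
    using has_top_mult[OF has_top_theta_poly_linear has_top_theta_poly_linear] by simp
  from has_top_theta_op[OF this has_top_theta_poly_linear]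
  show ?thesis by (simp add: numeral_2_eq_2 flip: to_fract_mult to_fract_add)
qed

lemma SE4_shift_c_u:
  "reducible_op (SE4 a b (c + 1) g (u + 2)) \<longleftrightarrow> reducible_op (SE4 a b c g u)"
proof -
  define e e' where "e = SE4_exponents a b c g u" and "e' = SE4_exponents a b (c + 1) g (u + 2)"
  \<comment> \<open>Only \<open>e 2\<close>, \<open>e 4\<close> (by -1) and \<open>e 5\<close> (by 2) change, which fixes \<open>P\<close> and \<open>Q\<close> up to \<open>z\<close> by comparing
    the outer coefficients of \<open>E' P = Q E\<close>.\<close>
  define z where "z = 1 - e 1 - e 3 - e 5"
  define P where "P = theta_op ([:e 5, 1:] * [:z, 1:]) [:e 1 - 1, - 1:] 0 0"
  define Q where "Q = theta_op ([:e 5 + 2, 1:] * [:z, 1:]) [:e 1 - 2, - 1:] 0 0"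
  note T10 = T10_times_54[of e] T10_times_54[of e']
  have "E4 e' * P = Q * E4 e"
    unfolding E4_theta P_def Q_def theta_op_mult_1_2 theta_op_mult_2_1
    by (intro theta_op_cong; rule poly_ext; (simp only: e_def e'_def z_def poly_eval)?;
        (algebra | (insert T10, simp only: e_def e'_def z_def poly_eval, algebra)))
  thus ?thesis
    unfolding SE4_def e_def e'_def P_def
    by (rule E4_intertwine[OF _ has_top_theta_op_quadratic]) auto
qed

text \<open>At \<open>a = 0\<close> one has \<open>e 8 = - e 3\<close>, and the right factor
  \<open>(x - 1) \<partial> - e 3\<close> has the solution \<open>(x - 1)\<close> to the power
  \<open>e 3\<close>. Likewise, at \<open>b = 0\<close> one has \<open>e 8 = - e 1\<close>, with
  solution \<open>x\<close> to the power \<open>e 1\<close>.\<close>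

lemma SE4_factor_a: "reducible_op (SE4 0 b c g u)"
proof -
  define e where "e = SE4_exponents 0 b c g u"
  note T10 = T10_times_54[of e]
  have E: "E4 e = theta_op ([:e 5, 1:] * [:e 6, 1:] * [:e 7, 1:])
      (- ([:2 - e 1, 1:] * [:2 - e 2, 1:])) 0 0 * theta_op [:- e 3, 1:] [:- 1:] 0 0"
    unfolding E4_theta theta_op_mult_1_2
    by (intro theta_op_cong; rule poly_ext; (simp only: e_def poly_eval)?;
        (algebra | (insert T10, simp only: e_def poly_eval, algebra)))
  have "has_top (theta_op [:- e 3, 1:] [:- 1:] 0 0) 1 (to_fract [:-1, 1:])"
    using has_top_theta_op[OF has_top_theta_poly_linear[unfolded One_nat_def]
        has_top_theta_poly_const, of "- e 3" 1 "- 1"] by (simp flip: to_fract_add)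
  from reducible_E4I[OF E this] show ?thesis unfolding SE4_def e_def by simp
qed

lemma SE4_factor_b: "reducible_op (SE4 a 0 c g u)"
proof -
  define e where "e = SE4_exponents a 0 c g u"
  note T10 = T10_times_54[of e]
  \<comment> \<open>The image of the factorization for \<open>a = 0\<close> under the exchange \<open>x \<mapsto> 1 - x\<close> of \<open>a\<close> and \<open>b\<close>, which sends
    \<open>\<theta>\<close> to \<open>\<theta> - \<partial>\<close> and \<open>\<partial>\<close> to \<open>-\<partial>\<close>.\<close>
  have E: "E4 e = theta_op ([:e 5, 1:] * [:e 6, 1:] * [:e 7, 1:])
      ([:2 - e 3, 1:] * [:2 - e 4, 1:] - [:e 6 + 1, 1:] * [:e 7 + 1, 1:]
        - [:e 5, 1:] * [:e 7 + 1, 1:] - [:e 5, 1:] * [:e 6, 1:]) [:2 - e 2, 1:] 0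
      * theta_op [:- e 1, 1:] 0 0 0"
    unfolding E4_theta theta_op_mult_2_1
    by (intro theta_op_cong; rule poly_ext; (simp only: e_def poly_eval)?;
        (algebra | (insert T10, simp only: e_def poly_eval, algebra)))
  have "has_top (theta_op [:- e 1, 1:] 0 0 0) 1 (to_fract [:0, 1:])"
    using has_top_theta_poly_linear[of "- e 1" 1] by (simp add: theta_op_def)
  from reducible_E4I[OF E this] show ?thesis unfolding SE4_def e_def by simp
qed

text \<open>Both factors are Gauss hypergeometric operators, of the form \<open>(\<theta> +
  \<alpha>) (\<theta> + \<beta>) - (\<theta> + \<gamma>) \<partial>\<close>.\<close>

lemma SE4_factor_g: "reducible_op (SE4 a b c (- 1) u)"
proof -
  define e where "e = SE4_exponents a b c (- 1) u"
  note T10 = T10_times_54[of e]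
  have E: "E4 e = theta_op ([:e 5, 1:] * [:e 6, 1:]) [:e 2 - 2, - 1:] 0 0
      * theta_op ([:e 7, 1:] * [:e 8, 1:]) [:e 1 - 1, - 1:] 0 0"
    unfolding E4_theta theta_op_mult_1_2
    by (intro theta_op_cong; rule poly_ext; (simp only: e_def poly_eval)?;
        (algebra | (insert T10, simp only: e_def poly_eval, algebra)))
  from reducible_E4I[OF E has_top_theta_op_quadratic] show ?thesis
    unfolding SE4_def e_def by simp
qed

section \<open>Parameter symmetries and integrality conditions\<close>

text \<open>The shift of \<open>u\<close> is by \<open>e 5 - e 7 = 2 * c + 1\<close>; the changes of
  \<open>c\<close> and \<open>g\<close> restore the other six exponents.\<close>

lemma SE4_swap_5_7:
  "SE4 a b (- c - 1) (g + 2 * c + 1) (u - 2 * c - 1) = SE4 a b c g u"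
  unfolding SE4_def by (rule E4_cong) (simp_all add: SE4_exponents_simps algebra_simps)

text \<open>Here \<open>2 * k\<close> is the difference \<open>e 5 - e 8\<close>.\<close>

lemma SE4_swap_5_8:
  assumes "k = a + b + c + g / 2 + 3 / 2"
  shows "SE4 (a - k) (b - k) (c - k) (g + 2 * k) (u - 2 * k) = SE4 a b c g u"
  unfolding SE4_def using assms
  by (intro E4_cong) (simp_all add: SE4_exponents_simps field_simps)

lemma complex_shift_int:
  fixes f :: "complex \<Rightarrow> bool"
  assumes "\<And>z. f (z + 1) \<longleftrightarrow> f z"
  shows "f (z + of_int k) \<longleftrightarrow> f z"
proof (induction k rule: int_induct[of _ 0])
  case (step1 i)
  thus ?case using assms[of "z + of_int i"] by (simp add: add_ac)
next
  case (step2 i)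
  thus ?case using assms[of "z + of_int (i - 1)"] by simp
qed simp

lemma SE4_shift_u_int:
  "reducible_op (SE4 a b c g (u + of_int k)) \<longleftrightarrow> reducible_op (SE4 a b c g u)"
  by (rule complex_shift_int[where f = "\<lambda>u. reducible_op (SE4 a b c g u)", OF SE4_shift_u])

lemma SE4_shift_c_int:
  "reducible_op (SE4 a b (c + of_int k) g u) \<longleftrightarrow> reducible_op (SE4 a b c g u)"
proof (rule complex_shift_int[where f = "\<lambda>c. reducible_op (SE4 a b c g u)"])
  fix c
  show "reducible_op (SE4 a b (c + 1) g u) \<longleftrightarrow> reducible_op (SE4 a b c g u)"
    using SE4_shift_c_u[of a b c g u] SE4_shift_u_int[of a b "c + 1" g u 2] by simp
qed

text \<open>Each of these exponents is \<open>u\<close> plus a term free of \<open>u\<close>, so an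
  integer shift of \<open>u\<close> makes it 0.\<close>

lemma SE4_integer_exponent:
  assumes "SE4_exponents a b c g u i \<in> \<int>" "i \<in> {5, 6, 7, 8}"
  shows "reducible_op (SE4 a b c g u)"
proof -
  from assms obtain n where n: "SE4_exponents a b c g u i = of_int n" by (metis Ints_cases)
  have "SE4_exponents a b c g (u + of_int (- n)) i = SE4_exponents a b c g u i - of_int n"
    using assms(2) by (auto simp: SE4_exponents_simps algebra_simps)
  hence "SE4_exponents a b c g (u + of_int (- n)) i = 0" using n by simp
  hence "reducible_op (SE4 a b c g (u + of_int (- n)))"
    unfolding SE4_def using assms(2) by (intro E4_factor_at_infinity) auto
  thus ?thesis unfolding SE4_shift_u_int .
qed

text \<open>An integer shift of \<open>c\<close> gives \<open>g + 2 * c + 1 = - 1\<close>, which is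
  the value of \<open>g\<close> after exchanging \<open>e 5\<close> and \<open>e 7\<close>.\<close>

lemma SE4_integer_c_g:
  assumes "c + g / 2 + 1 \<in> \<int>"
  shows "reducible_op (SE4 a b c g u)"
proof -
  from assms obtain n where n: "c + g / 2 + 1 = of_int n" by (metis Ints_cases)
  define c' where "c' = c + of_int (- n)"
  have "g + 2 * c' + 1 = - 1" using n by (simp add: c'_def field_simps)
  hence "reducible_op (SE4 a b c' g u)"
    using SE4_factor_g SE4_swap_5_7[of a b c' g u] by metis
  thus ?thesis unfolding c'_def SE4_shift_c_int .
qed

text \<open>The same exchange reduces this condition on \<open>g\<close> to the previous one, so no
  shift of \<open>g\<close> is required.\<close>

lemma SE4_integer_g:
  assumes "(g + 1) / 2 \<in> \<int>"
  shows "reducible_op (SE4 a b c g u)"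
proof -
  have "(- c - 1) + (g + 2 * c + 1) / 2 + 1 = (g + 1) / 2" by (simp add: field_simps)
  hence "reducible_op (SE4 a b (- c - 1) (g + 2 * c + 1) (u - 2 * c - 1))"
    using assms by (intro SE4_integer_c_g) (simp only:)
  thus ?thesis by (simp only: SE4_swap_5_7)
qed

lemma SE4_integer_a_b_c_g:
  assumes "a + b + c + g + 2 \<in> \<int>"
  shows "reducible_op (SE4 a b c g u)"
proof -
  define k where "k = a + b + c + g / 2 + 3 / 2"
  have "(g + 2 * k + 1) / 2 = a + b + c + g + 2" by (simp add: k_def field_simps)
  hence "reducible_op (SE4 (a - k) (b - k) (c - k) (g + 2 * k) (u - 2 * k))"
    using assms by (intro SE4_integer_g) (simp only:)
  thus ?thesis by (simp only: SE4_swap_5_8[OF k_def])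
qed

lemma SE4_integer_half:
  assumes "b + c + g / 2 + 3 / 2 \<in> \<int> \<or> a + c + g / 2 + 3 / 2 \<in> \<int>"
  shows "reducible_op (SE4 a b c g u)"
proof -
  from assms obtain n where
    n: "b + c + g / 2 + 3 / 2 = of_int n \<or> a + c + g / 2 + 3 / 2 = of_int n"
    by (metis Ints_cases)
  define c' where "c' = c + of_int (- n)"
  define k where "k = a + b + c' + g / 2 + 3 / 2"
  \<comment> \<open>\<open>a - k\<close> and \<open>b - k\<close> are the negatives of the two
    expressions in the assumption, with \<open>c'\<close> for \<open>c\<close>.\<close>
  have "a - k = 0 \<or> b - k = 0" using n by (auto simp: c'_def k_def algebra_simps)
  hence "reducible_op (SE4 (a - k) (b - k) (c' - k) (g + 2 * k) (u - 2 * k))"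
    using SE4_factor_a SE4_factor_b by metis
  hence "reducible_op (SE4 a b c' g u)" by (simp only: SE4_swap_5_8[OF k_def])
  thus ?thesis unfolding c'_def SE4_shift_c_int .
qed

text \<open>Exchanging \<open>e 5\<close> and \<open>e 7\<close> leads back to
  \<open>SE4_integer_half\<close>.\<close>

lemma SE4_integer_a_g:
  assumes "b + g / 2 + 1 \<in> \<int> \<or> a + g / 2 + 1 \<in> \<int>"
  shows "reducible_op (SE4 a b c g u)"
proof -
  have "y + (- c - 1) + (g + 2 * c + 1) / 2 + 3 / 2 = y + g / 2 + 1" for y :: complex
    by (simp add: field_simps)
  hence "reducible_op (SE4 a b (- c - 1) (g + 2 * c + 1) (u - 2 * c - 1))"
    using assms by (intro SE4_integer_half) (simp only:)
  thus ?thesis by (simp only: SE4_swap_5_7)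
qed

text \<open>Exchanging \<open>e 5\<close> and \<open>e 8\<close> leads back to
  \<open>SE4_integer_half\<close>, which extends the cases \<open>a = 0\<close> and
  \<open>b = 0\<close> to all integers.\<close>

lemma SE4_integer_a_or_b:
  assumes "- a \<in> \<int> \<or> - b \<in> \<int>"
  shows "reducible_op (SE4 a b c g u)"
proof -
  define k where "k = a + b + c + g / 2 + 3 / 2"
  have "(b - k) + (c - k) + (g + 2 * k) / 2 + 3 / 2 = - a"
    "(a - k) + (c - k) + (g + 2 * k) / 2 + 3 / 2 = - b"
    by (simp_all add: k_def field_simps)
  hence "reducible_op (SE4 (a - k) (b - k) (c - k) (g + 2 * k) (u - 2 * k))"
    using assms by (intro SE4_integer_half) (simp only:)
  thus ?thesis by (simp only: SE4_swap_5_8[OF k_def])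
qed

theorem theorem10p4:
  fixes a b c g u :: complex
  assumes "\<exists>v \<in> {- a, - b, (g + 1) / 2, a + g / 2 + 1, b + g / 2 + 1, c + g / 2 + 1,
                   a + b + c + g + 2, a + c + g / 2 + 3 / 2, b + c + g / 2 + 3 / 2,
                   SE4_exponents a b c g u 5, SE4_exponents a b c g u 6,
                   SE4_exponents a b c g u 7, SE4_exponents a b c g u 8}. v \<in> \<int>"
  shows "reducible_op (SE4 a b c g u)"
  using assms
  by (elim bexE insertE emptyE; hypsubst?)
     (blast intro: SE4_integer_a_or_b SE4_integer_g SE4_integer_a_g SE4_integer_c_g
        SE4_integer_a_b_c_g SE4_integer_half SE4_integer_exponent)+

end
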